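(* Let $A_0\ge 1$ be a fixed constant. There exists a constant $C>0$, depending only on $A_0$, such that the following holds. Let $n\ge 2$ be an integer and let $$q(t)=\sum_{\lambda\in\Gamma}b_\lambda e^{\lambda t}$$ be a reduced exponential polynomial of exact order $n$. Put $\rho=\operatorname{diam}\Gamma$ and assume $\rho>A_0 n$. Let $a\in\Gamma$ and define $$Q_a=\rho^{-1}(D-a)q.$$ Then, for every $u>0$, $$\left|\left\{t\in I_0: q(t)\neq0,\ |Q_a(t)|>u|q(t)|\right\}\right|\le\frac{C}{u}.$$
   Context: $I_0=[-1/2,1/2]$; $D=d/dt$, so $(D-a)q=q'-aq$. The sum being reduced of exact order $n$ means that $\Gamma\subset\mathbb C$ is a set of exactly $n$ distinct exponents and all $b_\lambda\in\mathbb C\setminus\{0\}$. $\operatorname{diam}\Gamma=\max_{\lambda,\mu\in\Gamma}|\lambda-\mu|$. $|\cdot|$ applied to a subset of $\mathbb R$ denotes Lebesgue measure. *)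

theory Defs
  imports "HOL-Analysis.Analysis"
begin

definition exp_poly :: "complex set \<Rightarrow> (complex \<Rightarrow> complex) \<Rightarrow> real \<Rightarrow> complex" where
  "exp_poly \<Gamma> b t = (\<Sum>z\<in>\<Gamma>. b z * exp (z * of_real t))"

definition reduced_of_exact_order :: "nat \<Rightarrow> complex set \<Rightarrow> (complex \<Rightarrow> complex) \<Rightarrow> bool" where
  "reduced_of_exact_order n \<Gamma> b \<longleftrightarrow> finite \<Gamma> \<and> card \<Gamma> = n \<and> (\<forall>z\<in>\<Gamma>. b z \<noteq> 0)"

text \<open>The operator $D - a$ with $D = d/dt$, acting on complex-valued functions of a real variable.\<close>
definition D_minus :: "complex \<Rightarrow> (real \<Rightarrow> complex) \<Rightarrow> real \<Rightarrow> complex" where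
  "D_minus a q t = vector_derivative q (at t) - a * q t"

definition Q_quot :: "complex set \<Rightarrow> (complex \<Rightarrow> complex) \<Rightarrow> complex \<Rightarrow> real \<Rightarrow> complex" where
  "Q_quot \<Gamma> b a t = D_minus a (exp_poly \<Gamma> b) t / of_real (diameter \<Gamma>)"

definition I\<^sub>0 :: "real set" where
  "I\<^sub>0 = {- 1/2 .. 1/2}"

lemma exp_poly_has_vector_derivative:
  "(exp_poly \<Gamma> b has_vector_derivative (\<Sum>z\<in>\<Gamma>. b z * (z * exp (z * of_real t)))) (at t)"
proof -
  have "((\<lambda>w. \<Sum>z\<in>\<Gamma>. b z * exp (z * w)) has_field_derivative
      (\<Sum>z\<in>\<Gamma>. b z * (z * exp (z * of_real t)))) (at (of_real t))"
    by (auto intro!: derivative_eq_intros sum.cong simp: mult_ac)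
  from has_vector_derivative_real_field[OF this]
  show ?thesis unfolding exp_poly_def .
qed

text \<open>
  \<^const>\<open>measure\<close> takes the value \<open>0\<close> on non-measurable sets and on sets of infinite measure;
  the next lemma rules out both for the sets under consideration.
\<close>
lemma large_ratio_set_lmeasurable:
  "{t \<in> I\<^sub>0. exp_poly \<Gamma> b t \<noteq> 0 \<and>
     norm (Q_quot \<Gamma> b a t) > u * norm (exp_poly \<Gamma> b t)} \<in> lmeasurable"
  (is "?S \<in> _")
proof -
  have vd: "vector_derivative (exp_poly \<Gamma> b) (at t) =
      (\<Sum>z\<in>\<Gamma>. b z * (z * exp (z * of_real t)))" for t
    by (rule vector_derivative_at[OF exp_poly_has_vector_derivative])
  have cq: "continuous_on UNIV (exp_poly \<Gamma> b)"
    unfolding exp_poly_def by (intro continuous_intros)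
  have cQ: "continuous_on UNIV (Q_quot \<Gamma> b a)"
    unfolding Q_quot_def D_minus_def vd divide_inverse
    by (intro continuous_intros continuous_on_subset[OF cq]) auto
  have "open {t. exp_poly \<Gamma> b t \<noteq> 0}"
    by (rule open_Collect_neq[OF cq continuous_on_const])
  moreover have "open {t. u * norm (exp_poly \<Gamma> b t) < norm (Q_quot \<Gamma> b a t)}"
    by (rule open_Collect_less) (intro continuous_intros cq cQ)+
  ultimately have "open ({t. exp_poly \<Gamma> b t \<noteq> 0} \<inter>
      {t. u * norm (exp_poly \<Gamma> b t) < norm (Q_quot \<Gamma> b a t)})" (is "open ?U")
    by (rule open_Int)
  moreover have "?S = I\<^sub>0 \<inter> ?U"
    by auto
  ultimately show ?thesis
    unfolding I\<^sub>0_def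
    by (simp add: fmeasurable_Int_fmeasurable borel_open)
qed

end

theory Submission
  imports Defs "HOL-Complex_Analysis.Complex_Analysis"
begin

text \<open>
  Multiplying by $e^{-at}$ reduces to $a = 0$, where the claim is a weak-type bound for the
  logarithmic derivative of an entire function $f$ with frequencies of modulus at most $\rho$
  and fewer than $\rho$ terms. Since $f$ is annihilated by $\prod (D - \lambda)$, its growth on a
  disc is at most $e^{O(\rho)}$ times its maximum on a smaller one. Hence, by Jensen and
  Borel--Caratheodory, $f'/f$ differs by $O(\rho)$ from a sum of $N = O(\rho)$ simple fractions
  $1/(t - w)$. For poles in the lower half plane, $G(z) = i \sum 1/(z - w)$ has nonnegative real
  part on the upper half plane, and $\mathrm{Re}\,(G/(G+u)) \ge 1/2$ wherever $|G| \ge u$; integrating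
  the holomorphic function $G/(G+u)$ over a half disc gives measure $O(N/u)$.
\<close>

subsection \<open>Growth of exponential sums\<close>

text \<open>The induction removes one frequency $m$ by passing to $(D - m) f$, and recovers $f$ by integrating
  $e^{-mz} f$; the hypothesis bounds only as many Taylor coefficients as there are frequencies.\<close>

lemma exp_sum_growth:
  fixes \<Gamma> :: "complex set" and b :: "complex \<Rightarrow> complex"
  assumes "finite \<Gamma>" and "\<And>l. l \<in> \<Gamma> \<Longrightarrow> norm l \<le> \<rho>" and "0 \<le> \<sigma>" "0 \<le> \<rho>"
    and "\<And>k. k < card \<Gamma> \<Longrightarrow> norm (\<Sum>l\<in>\<Gamma>. b l * l ^ k) \<le> M * \<sigma> ^ k" and "0 \<le> M"
  shows "norm (\<Sum>l\<in>\<Gamma>. b l * exp (l * z)) \<le> M * exp ((2 * \<rho> + \<sigma>) * norm z)"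
  using assms
proof (induction \<Gamma> arbitrary: b M z rule: finite_induct)
  case empty
  then show ?case by simp
next
  case (insert m \<Gamma>)
  define f where "f w = (\<Sum>l\<in>insert m \<Gamma>. b l * exp (l * w))" for w
  define g where "g w = (\<Sum>l\<in>\<Gamma>. (b l * (l - m)) * exp (l * w))" for w
  have m: "norm m \<le> \<rho>" using insert.prems by simp
  have mom: "norm (\<Sum>l\<in>\<Gamma>. (b l * (l - m)) * l ^ k) \<le> M * (\<sigma> + \<rho>) * \<sigma> ^ k" if "k < card \<Gamma>" for k
  proof -
    \<comment> \<open>The term at \<open>m\<close> is zero, so it may be added. The moments of
      \<open>g\<close> then combine those of \<open>f\<close> of orders k + 1 and k, both below the
      cardinality of \<open>insert m \<Gamma>\<close>.\<close>
    have "(\<Sum>l\<in>\<Gamma>. (b l * (l - m)) * l ^ k) = (\<Sum>l\<in>insert m \<Gamma>. (b l * (l - m)) * l ^ k)"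
      using insert.hyps by simp
    also have "\<dots> = (\<Sum>l\<in>insert m \<Gamma>. b l * l ^ Suc k) - m * (\<Sum>l\<in>insert m \<Gamma>. b l * l ^ k)"
      unfolding sum_distrib_left sum_subtractf[symmetric] by (rule sum.cong) (auto simp: algebra_simps)
    also have "norm \<dots> \<le> norm (\<Sum>l\<in>insert m \<Gamma>. b l * l ^ Suc k) + norm m * norm (\<Sum>l\<in>insert m \<Gamma>. b l * l ^ k)"
      by (rule order.trans[OF norm_triangle_ineq4]) (simp add: norm_mult)
    also have "\<dots> \<le> M * \<sigma> ^ Suc k + \<rho> * (M * \<sigma> ^ k)"
      using that insert.hyps insert.prems m by (intro add_mono mult_mono insert.prems(4)) auto
    finally show ?thesis by (simp add: algebra_simps)
  qed
  have g: "norm (g w) \<le> M * (\<sigma> + \<rho>) * exp ((2 * \<rho> + \<sigma>) * norm w)" for w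
    unfolding g_def using insert.prems mom by (intro insert.IH) auto
  define c where "c = \<sigma> + \<rho>"
  have g: "norm (g w) \<le> M * c * exp ((\<rho> + c) * norm w)" for w
    using g[of w] by (simp add: c_def algebra_simps)
  \<comment> \<open>\<open>F\<close> joins exp(m z) f(0) to f(z) along the segment from 0 to
    \<open>z\<close>; the exponential factor is chosen so that the derivative involves only g = f' -
    m f.\<close>
  define F where "F s = exp (m * (1 - of_real s) * z) * f (of_real s * z)" for s :: real
  define F' where "F' s = z * exp (m * (1 - of_real s) * z) * g (of_real s * z)" for s :: real
  have "(F has_vector_derivative F' s) (at s)" for s
  proof -
    have df: "(f has_field_derivative (\<Sum>l\<in>insert m \<Gamma>. b l * (l * exp (l * w)))) (at w)" for w
      unfolding f_def by (auto intro!: derivative_eq_intros sum.cong simp: mult_ac)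
    have "((\<lambda>s. exp (m * (1 - s) * z) * f (s * z)) has_field_derivative
        exp (m * (1 - s) * z) * ((\<Sum>l\<in>insert m \<Gamma>. b l * (l * exp (l * (s * z)))) * z)
        + (- m * z * exp (m * (1 - s) * z)) * f (s * z)) (at s)" for s
      by (rule derivative_eq_intros DERIV_chain2[OF df] refl | simp add: mult_ac)+
    moreover have "exp (m * (1 - s) * z) * ((\<Sum>l\<in>insert m \<Gamma>. b l * (l * exp (l * (s * z)))) * z)
        + (- m * z * exp (m * (1 - s) * z)) * f (s * z) = z * exp (m * (1 - s) * z) * g (s * z)" for s
    proof -
      have eq: "(\<Sum>l\<in>insert m \<Gamma>. b l * (l * exp (l * (s * z)))) = g (s * z) + m * f (s * z)"
        using insert.hyps unfolding g_def f_def sum_distrib_left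
        by (simp add: algebra_simps sum_subtractf sum_distrib_left sum.distrib)
      show ?thesis unfolding eq by algebra
    qed
    ultimately have "((\<lambda>s. exp (m * (1 - s) * z) * f (s * z)) has_field_derivative
        z * exp (m * (1 - s) * z) * g (s * z)) (at s)" for s by simp
    from has_vector_derivative_real_field[OF this] show ?thesis
      unfolding F_def F'_def .
  qed
  note dF = this
  \<comment> \<open>Comparison function: its derivative is exactly the bound for \<open>F'\<close>,
    and \<open>P 0\<close> is the bound for \<open>F 0\<close>, so \<open>P 1\<close> is the claimed
    bound for f(z).\<close>
  define P where "P s = M * exp (\<rho> * norm z) * exp (c * s * norm z)" for s
  have dP: "(P has_vector_derivative M * exp (\<rho> * norm z) * (c * norm z * exp (c * s * norm z))) (at s)" for s
    unfolding P_def has_real_derivative_iff_has_vector_derivative[symmetric]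
    by (auto intro!: derivative_eq_intros)
  have "norm (F 1 - F 0) \<le> P 1 - P 0"
  proof (rule differentiable_bound_general[OF _ _ _ dF dP])
    show "continuous_on {0..1} F" "continuous_on {0..1} P"
      by (meson continuous_at_imp_continuous_on has_vector_derivative_continuous dF dP)+
    fix s :: real assume s: "0 < s" "s < 1"
    have "norm (exp (m * (1 - of_real s) * z)) \<le> exp (norm (m * (1 - of_real s) * z))"
      by (rule norm_exp)
    also have "norm (m * (1 - of_real s) * z) = norm m * (1 - s) * norm z"
      using s by (simp add: norm_mult) (metis abs_of_pos diff_gt_0_iff_gt norm_of_real of_real_1 of_real_diff)
    also have "exp (norm m * (1 - s) * norm z) \<le> exp (\<rho> * (1 - s) * norm z)"
      using s m by (simp add: mult_right_mono)
    finally have e: "norm (exp (m * (1 - of_real s) * z)) \<le> exp (\<rho> * (1 - s) * norm z)" .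
    have "norm (F' s) \<le> norm z * exp (\<rho> * (1 - s) * norm z) * (M * c * exp ((\<rho> + c) * (s * norm z)))"
      unfolding F'_def norm_mult using e g[of "of_real s * z"] s
      by (intro mult_mono) (auto simp: norm_mult)
    also have "\<dots> = M * exp (\<rho> * norm z) * (c * norm z * exp (c * s * norm z))"
      by (simp add: algebra_simps flip: exp_add)
    finally show "norm (F' s) \<le> M * exp (\<rho> * norm z) * (c * norm z * exp (c * s * norm z))" .
  qed auto
  moreover have "norm (F 0) \<le> M * exp (\<rho> * norm z)"
  proof -
    have "norm (f 0) \<le> M"
      using insert.prems(4)[of 0] insert.hyps by (simp add: f_def)
    moreover have "norm (exp (m * z)) \<le> exp (\<rho> * norm z)"
      by (rule order.trans[OF norm_exp]) (simp add: norm_mult m mult_right_mono)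
    ultimately show ?thesis
      unfolding F_def by (subst mult.commute, auto simp: norm_mult intro!: mult_mono insert.prems)
  qed
  ultimately have "norm (F 1) \<le> P 1 - P 0 + M * exp (\<rho> * norm z)"
    using norm_triangle_sub[of "F 1" "F 0"] by linarith
  then show ?case
    by (simp add: F_def P_def f_def c_def algebra_simps flip: exp_add)
qed

text \<open>The moments are the derivatives of the sum at 0. Cauchy's inequality bounds them by k! M
  / r^k, and k! <= k^k <= (card \<Gamma>)^k for k < card \<Gamma>, so \<open>exp_sum_growth\<close>
  applies with \<sigma> = card \<Gamma> / r.\<close>

lemma exp_sum_growth_cball:
  fixes \<Gamma> :: "complex set" and b :: "complex \<Rightarrow> complex"
  assumes "finite \<Gamma>" and "\<And>l. l \<in> \<Gamma> \<Longrightarrow> norm l \<le> \<rho>" and "0 \<le> \<rho>" "0 < r"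
    and bd: "\<And>w. norm w \<le> r \<Longrightarrow> norm (\<Sum>l\<in>\<Gamma>. b l * exp (l * w)) \<le> M"
  shows "norm (\<Sum>l\<in>\<Gamma>. b l * exp (l * z)) \<le> M * exp ((2 * \<rho> + card \<Gamma> / r) * norm z)"
proof (rule exp_sum_growth)
  fix k assume k: "k < card \<Gamma>"
  define f where "f = (\<lambda>w. \<Sum>l\<in>\<Gamma>. b l * exp (l * w))"
  have dk: "(deriv ^^ j) f = (\<lambda>w. \<Sum>l\<in>\<Gamma>. b l * l ^ j * exp (l * w))" for j
  proof (induction j)
    case 0
    then show ?case by (simp add: f_def)
  next
    case (Suc j)
    have "deriv (\<lambda>w. \<Sum>l\<in>\<Gamma>. b l * l ^ j * exp (l * w)) w = (\<Sum>l\<in>\<Gamma>. b l * l ^ Suc j * exp (l * w))" for w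
      by (rule DERIV_imp_deriv) (auto intro!: derivative_eq_intros sum.cong simp: mult_ac)
    then show ?case using Suc by auto
  qed
  have "norm ((deriv ^^ k) f 0) \<le> fact k * M / r ^ k"
  proof (rule Cauchy_inequality)
    show "f holomorphic_on ball 0 r" "continuous_on (cball 0 r) f"
      unfolding f_def by (intro holomorphic_intros continuous_intros)+
  qed (use assms in \<open>auto simp: f_def\<close>)
  also have "\<dots> \<le> real (card \<Gamma>) ^ k * M / r ^ k"
  proof -
    have "fact k \<le> real k ^ k" by (metis fact_le_power order_refl of_nat_fact of_nat_le_iff of_nat_power)
    also have "\<dots> \<le> real (card \<Gamma>) ^ k" using k by (intro power_mono) auto
    finally show ?thesis using bd[of 0] \<open>0 < r\<close>
      by (intro divide_right_mono mult_right_mono) (auto intro: order.trans[OF norm_ge_zero])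
  qed
  finally show "norm (\<Sum>l\<in>\<Gamma>. b l * l ^ k) \<le> M * (card \<Gamma> / r) ^ k"
    unfolding dk by (simp add: power_divide mult_ac)
next
  show "0 \<le> M" using bd[of 0] \<open>0 < r\<close> by (auto intro: order.trans[OF norm_ge_zero])
qed (use assms in auto)

subsection \<open>Logarithmic derivatives and zeros\<close>

text \<open>Borel--Caratheodory: Schwarz's lemma applied to $L/(4A - L)$, where $L$ is the logarithm
  of $h/h(0)$.\<close>

lemma log_deriv_zero_free:
  assumes hol: "h holomorphic_on ball 0 (1/2)" and nz: "\<And>z. z \<in> ball 0 (1/2) \<Longrightarrow> h z \<noteq> 0"
    and bd: "\<And>z. z \<in> ball 0 (1/2) \<Longrightarrow> norm (h z) \<le> exp A * norm (h 0)"
    and A: "A > 0" and z: "norm z \<le> 1/8"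
  shows "norm (deriv h z / h z) \<le> 32 * A"
proof -
  obtain l where l: "l holomorphic_on ball 0 (1/2)" and hl: "\<And>z. z \<in> ball 0 (1/2) \<Longrightarrow> h z = exp (l z)"
    using contractible_imp_holomorphic_log[OF hol _ nz] convex_imp_contractible[OF convex_ball] by metis
  define L where "L z = l z - l 0" for z
  have L: "L holomorphic_on ball 0 (1/2)" unfolding L_def by (intro holomorphic_intros l)
  have re: "Re (L w) \<le> A" if "w \<in> ball 0 (1/2)" for w
  proof -
    have "norm (exp (l w)) \<le> exp A * norm (exp (l 0))"
      using bd[OF that] hl[OF that] hl[of 0] by simp
    then have "exp (Re (l w)) \<le> exp (A + Re (l 0))" by (simp add: exp_add)
    then show ?thesis by (simp add: L_def)
  qed
  have ne: "4 * of_real A - L w \<noteq> 0" if "w \<in> ball 0 (1/2)" for w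
    using re[OF that] A by (auto simp: complex_eq_iff)
  \<comment> \<open>Halving the argument turns the disc of radius 1/2 into the unit disc. Since Re L
    <= A < 2A, the value of L is nearer to 0 than to 4A, so |\<phi>| < 1.\<close>
  define \<phi> where "\<phi> w = L (w / 2) / (4 * of_real A - L (w / 2))" for w
  have hphi: "\<phi> holomorphic_on ball 0 1"
    unfolding \<phi>_def
    by (intro holomorphic_intros holomorphic_on_compose_gen[OF _ L, unfolded o_def]) (use ne in \<open>auto simp: norm_divide\<close>)
  have lt: "norm (\<phi> w) < 1" if "norm w < 1" for w
  proof -
    let ?x = "L (w / 2)"
    have w: "w / 2 \<in> ball 0 (1/2)" using that by (simp add: norm_divide)
    have "(norm ?x)\<^sup>2 < (norm (4 * of_real A - ?x))\<^sup>2"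
    proof -
      have "Re ?x * A \<le> A * A" using re[OF w] A by simp
      moreover have "0 < A * A" using A by simp
      ultimately show ?thesis
        unfolding cmod_power2 by (simp add: power2_eq_square algebra_simps)
    qed
    then have "norm ?x < norm (4 * of_real A - ?x)" by (simp add: power2_less_imp_less)
    then show ?thesis using ne[OF w] unfolding \<phi>_def norm_divide
      by (simp add: divide_less_eq)
  qed
  have sch: "norm (\<phi> w) \<le> norm w" if "norm w < 1" for w
    using Schwarz_Lemma(1)[OF hphi _ lt that] by (simp add: \<phi>_def L_def)
  \<comment> \<open>Here |\<phi>| <= 1/2, hence |L| <= (4A + |L|)/2, which solves to |L| <=
    4A.\<close>
  have Lb: "norm (L w) \<le> 4 * A" if "norm w \<le> 1/4" for w
  proof -
    have w: "w \<in> ball 0 (1/2)" using that by simp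
    have "norm (\<phi> (2 * w)) \<le> 1/2" using sch[of "2 * w"] that by (simp add: norm_mult)
    then have "norm (L w) \<le> 1/2 * norm (4 * of_real A - L w)"
      using ne[OF w] by (simp add: \<phi>_def norm_divide field_simps)
    also have "\<dots> \<le> 1/2 * (norm (4 * of_real A :: complex) + norm (L w))"
      by (intro mult_left_mono norm_triangle_ineq4) auto
    also have "norm (4 * of_real A :: complex) = 4 * A" using A by (simp add: norm_mult)
    finally show ?thesis by simp
  qed
  have zb: "z \<in> ball 0 (1/2)" using z by simp
  have sub: "cball z (1/8) \<subseteq> cball 0 (1/4)"
  proof
    fix x assume "x \<in> cball z (1/8)"
    then show "x \<in> cball 0 (1/4)"
      using z norm_triangle_sub[of x z] by (simp add: dist_norm norm_minus_commute)
  qed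
  then have sub2: "cball z (1/8) \<subseteq> ball 0 (1/2)"
    by (rule order.trans) auto
  \<comment> \<open>The disc of radius 1/8 about \<open>z\<close> stays in the quarter disc, where
    |L| <= 4A; this yields 4A / (1/8) = 32A.\<close>
  have "norm ((deriv ^^ 1) L z) \<le> fact 1 * (4 * A) / (1/8) ^ 1"
  proof (rule Cauchy_inequality)
    show "L holomorphic_on ball z (1/8)"
      by (rule holomorphic_on_subset[OF L]) (use sub2 ball_subset_cball in blast)
    show "continuous_on (cball z (1/8)) L"
      by (rule continuous_on_subset[OF holomorphic_on_imp_continuous_on[OF L]]) (use sub2 ball_subset_cball in blast)
    show "norm (L x) \<le> 4 * A" if "norm (z - x) = 1/8" for x
      using that sub by (intro Lb) (auto simp: dist_norm subset_iff)
  qed auto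
  moreover have "deriv L z = deriv h z / h z"
  proof -
    have dl: "(l has_field_derivative deriv l z) (at z)"
      using l zb holomorphic_derivI by blast
    have "deriv h z = deriv (\<lambda>z. exp (l z)) z"
      using hl zb by (intro deriv_cong_ev) (auto simp: eventually_nhds intro!: exI[of _ "ball 0 (1/2)"])
    also have "\<dots> = exp (l z) * deriv l z"
      by (rule DERIV_imp_deriv) (auto intro!: derivative_eq_intros dl)
    moreover have "deriv L z = deriv l z"
      unfolding L_def by (rule DERIV_imp_deriv) (auto intro!: derivative_eq_intros dl)
    ultimately show ?thesis using hl[OF zb] by simp
  qed
  ultimately show ?thesis by simp
qed

section \<open>Zeros in the disc and Blaschke factors\<close>

lemma norm_sum_list_le: "norm (\<Sum>x\<leftarrow>xs. f x :: 'a :: real_normed_vector) \<le> (\<Sum>x\<leftarrow>xs. norm (f x))"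
  by (induction xs) (auto intro: norm_triangle_mono)

text \<open>Lists count repeated zeros with multiplicity, and the logarithmic form of the derivative
  produces the sum of simple fractions.\<close>

lemma has_field_derivative_prod_list_div:
  fixes f :: "'b \<Rightarrow> 'a :: real_normed_field \<Rightarrow> 'a"
  assumes "\<And>w. w \<in> set ws \<Longrightarrow> (f w has_field_derivative f' w) (at z)"
    and "\<And>w. w \<in> set ws \<Longrightarrow> f w z \<noteq> 0"
  shows "((\<lambda>z. \<Prod>w\<leftarrow>ws. f w z) has_field_derivative (\<Prod>w\<leftarrow>ws. f w z) * (\<Sum>w\<leftarrow>ws. f' w / f w z)) (at z)"
  using assms
proof (induction ws)
  case (Cons w ws)
  have "((\<lambda>z. f w z * (\<Prod>w\<leftarrow>ws. f w z)) has_field_derivative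
      f' w * (\<Prod>w\<leftarrow>ws. f w z) + (\<Prod>w\<leftarrow>ws. f w z) * (\<Sum>w\<leftarrow>ws. f' w / f w z) * f w z) (at z)"
    by (rule DERIV_mult) (use Cons in auto)
  moreover have "f' w * (\<Prod>w\<leftarrow>ws. f w z) + (\<Prod>w\<leftarrow>ws. f w z) * (\<Sum>w\<leftarrow>ws. f' w / f w z) * f w z =
      (\<Prod>w\<leftarrow>w # ws. f w z) * (\<Sum>w\<leftarrow>w # ws. f' w / f w z)"
    using Cons.prems(2)[of w] by (simp add: field_simps)
  ultimately show ?case by simp
qed simp

lemma holomorphic_on_prod_list [holomorphic_intros]:
  assumes "\<And>w. w \<in> set ws \<Longrightarrow> f w holomorphic_on S"
  shows "(\<lambda>z. \<Prod>w\<leftarrow>ws. f w z) holomorphic_on S"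
  using assms by (induction ws) (auto intro!: holomorphic_intros)

lemma norm_prod_list: "norm (\<Prod>w\<leftarrow>ws. f w :: 'a :: real_normed_field) = (\<Prod>w\<leftarrow>ws. norm (f w))"
  by (induction ws) (auto simp: norm_mult)

text \<open>On the unit circle \<open>cnj z\<close> is the inverse of \<open>z\<close>. Replacing z
  - w by 1 - cnj w * z thus keeps the modulus there, and for |w| < 1 it removes the zero from the
  disc.\<close>

lemma norm_diff_eq_norm_one_minus_cnj_mult:
  assumes "norm z = 1" shows "norm (z - w) = norm (1 - cnj w * z)"
proof -
  have "norm (z - w) = norm (cnj z * (z - w))" using assms by (simp add: norm_mult)
  also have "cnj z * (z - w) = 1 - cnj z * w"
    using assms complex_norm_square[of z] by (simp add: algebra_simps)
  also have "norm \<dots> = norm (cnj (1 - cnj z * w))" by (simp only: complex_mod_cnj)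
  finally show ?thesis by (simp add: mult.commute)
qed

text \<open>Since $|z - w| = |1 - \bar w z|$ on the unit circle, every factorization of $f$ through $m$ zeros
  in the half-size disc satisfies $2^m \le e^A$; a factorization of maximal length leaves a zero-free
  cofactor.\<close>

lemma factor_out_zeros:
  assumes hol: "f holomorphic_on S" "open S" "cball 0 1 \<subseteq> S" and f0: "f 0 \<noteq> 0"
    and bd: "\<And>z. norm z = 1 \<Longrightarrow> norm (f z) \<le> exp A * norm (f 0)"
  obtains ws g where "\<And>w. w \<in> set ws \<Longrightarrow> norm w \<le> 1/2" "2 ^ length ws \<le> exp A"
    "g holomorphic_on S" "\<And>z. z \<in> S \<Longrightarrow> f z * (\<Prod>w\<leftarrow>ws. 1 - cnj w * z) = (\<Prod>w\<leftarrow>ws. z - w) * g z"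
    "\<And>z. norm z \<le> 1/2 \<Longrightarrow> g z \<noteq> 0" "\<And>z. norm z \<le> 1 \<Longrightarrow> norm (g z) \<le> exp A * norm (g 0)"
proof -
  define P where "P ws g \<longleftrightarrow> (\<forall>w\<in>set ws. norm w \<le> 1/2) \<and> g holomorphic_on S \<and>
     (\<forall>z\<in>S. f z = (\<Prod>w\<leftarrow>ws. z - w) * g z)" for ws g
  have dens: "(\<Prod>w\<leftarrow>ws. 1 - cnj w * z) \<noteq> 0" if "\<forall>w\<in>set ws. norm w \<le> 1/2" "norm z \<le> 1" for ws and z :: complex
  proof -
    have "1 - cnj w * z \<noteq> 0" if "w \<in> set ws" for w
    proof
      assume "1 - cnj w * z = 0"
      then have "1 = norm (cnj w * z)" by (metis eq_iff_diff_eq_0 norm_one)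
      also have "\<dots> \<le> 1/2 * 1" unfolding norm_mult
        by (intro mult_mono) (use that \<open>\<forall>w\<in>set ws. _\<close> \<open>norm z \<le> 1\<close> in auto)
      finally show False by simp
    qed
    then show ?thesis by (auto simp: prod_list_zero_iff)
  qed
  have main: "2 ^ length ws \<le> exp A \<and> norm (f 0) \<le> norm (g 0) \<and>
      (\<forall>z. norm z \<le> 1 \<longrightarrow> norm (g z * (\<Prod>w\<leftarrow>ws. 1 - cnj w * z)) \<le> exp A * norm (f 0))" if "P ws g" for ws g
  proof -
    \<comment> \<open>\<open>k\<close> is \<open>f\<close> with each factor z - w replaced by 1 -
      cnj w * z. Its modulus on the circle is that of \<open>f\<close>, so the maximum principle
      carries the bound to the whole disc.\<close>
    define k where "k z = g z * (\<Prod>w\<leftarrow>ws. 1 - cnj w * z)" for z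
    have ws: "\<forall>w\<in>set ws. norm w \<le> 1/2" and g: "g holomorphic_on S"
      and fg: "\<And>z. z \<in> S \<Longrightarrow> f z = (\<Prod>w\<leftarrow>ws. z - w) * g z" using that by (auto simp: P_def)
    have k: "k holomorphic_on S" unfolding k_def by (intro holomorphic_intros g)
    have kb: "norm (k z) \<le> exp A * norm (f 0)" if "norm z \<le> 1" for z
    proof (rule maximum_modulus_frontier[of k "cball 0 1"])
      show "k holomorphic_on interior (cball 0 1)"
        by (rule holomorphic_on_subset[OF k]) (use hol interior_subset in blast)
      show "continuous_on (closure (cball 0 1)) k"
        using holomorphic_on_imp_continuous_on[OF holomorphic_on_subset[OF k hol(3)]] by simp
      fix z :: complex assume "z \<in> frontier (cball 0 1)"
      then have z: "norm z = 1" by simp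
      then have "norm (k z) = norm (f z)"
        using fg[of z] subsetD[OF hol(3), of z] by (simp add: z k_def norm_mult norm_prod_list norm_diff_eq_norm_one_minus_cnj_mult[OF z])
      then show "norm (k z) \<le> exp A * norm (f 0)" using bd[OF z] by simp
    qed (use that in auto)
    \<comment> \<open>Jensen's estimate: with m zeros of modulus at most 1/2, 2^m |f(0)| <= |g(0)|,
      while g(0) = k(0) is at most e^A |f(0)| in modulus.\<close>
    have "(\<Prod>w\<leftarrow>ws. norm w) * 2 ^ length ws \<le> 1"
      using ws
    proof (induction ws)
      case (Cons w ws)
      have "(2 * norm w) * ((\<Prod>w\<leftarrow>ws. norm w) * 2 ^ length ws) \<le> 1 * 1"
        by (intro mult_mono) (use Cons in \<open>auto intro!: mult_nonneg_nonneg prod_list_nonneg\<close>)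
      then show ?case by (simp add: mult_ac)
    qed simp
    moreover have f0': "norm (f 0) = (\<Prod>w\<leftarrow>ws. norm w) * norm (g 0)"
      using fg[of 0] subsetD[OF hol(3), of 0] norm_prod_list[of uminus ws] by (simp add: norm_mult)
    ultimately have b: "norm (f 0) * 2 ^ length ws \<le> norm (g 0)"
      using mult_left_mono[of "(\<Prod>w\<leftarrow>ws. norm w) * 2 ^ length ws" 1 "norm (g 0)"] by (simp add: mult_ac)
    have "norm (g 0) \<le> exp A * norm (f 0)"
      using kb[of 0] by (simp add: k_def map_replicate_const)
    with b have "norm (f 0) * 2 ^ length ws \<le> norm (f 0) * exp A" by (simp add: mult.commute)
    then have "2 ^ length ws \<le> exp A" using f0 by simp
    moreover have "norm (f 0) * 1 \<le> norm (f 0) * 2 ^ length ws"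
      by (intro mult_left_mono) auto
    then have "norm (f 0) \<le> norm (g 0)" using b by linarith
    ultimately show ?thesis using kb unfolding k_def by blast
  qed
  \<comment> \<open>The length m of a factorization satisfies m < 2^m <= e^A < K, so a maximal
    length exists.\<close>
  obtain K :: nat where K: "exp A < real K" using reals_Archimedean2 by blast
  define Q where "Q m \<longleftrightarrow> (\<exists>ws g. P ws g \<and> length ws = m)" for m
  have bound: "m \<le> K" if "Q m" for m
  proof -
    from that obtain ws g where "P ws g" "length ws = m" unfolding Q_def by blast
    moreover have "real m < 2 ^ m" by (rule of_nat_less_two_power)
    moreover have "2 ^ length ws \<le> exp A" using main \<open>P ws g\<close> by blast
    ultimately have "real m < real K" using K by (metis less_le_trans less_trans)
    then show ?thesis by simp
  qed
  have "P [] f" using hol by (simp add: P_def)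
  then have Q0: "Q 0" by (auto simp: Q_def)
  have "Q (Greatest Q)" by (rule GreatestI_nat[of Q, OF Q0 bound])
  then obtain ws g where Pw: "P ws g" and lw: "length ws = Greatest Q" unfolding Q_def by blast
  have nz: "g z \<noteq> 0" if "norm z \<le> 1/2" for z
  proof
    assume gz: "g z = 0"
    \<comment> \<open>The difference quotient with its removable singularity filled in; it would
      lengthen the factorization by the zero \<open>z\<close>, against maximality.\<close>
    define g' where "g' x = (if x = z then deriv g z else (g x - g z) / (x - z))" for x
    have "g' holomorphic_on S"
      unfolding g'_def using pole_lemma_open Pw hol(2) by (auto simp: P_def)
    moreover have "g x = (x - z) * g' x" for x using gz by (auto simp: g'_def)
    ultimately have "P (z # ws) g'" using Pw that by (auto simp: P_def mult_ac)
    then have "Q (Suc (length ws))" unfolding Q_def by (intro exI[of _ "z # ws"] exI[of _ g']) simp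
    from Greatest_le_nat[of Q, OF this bound] have "Suc (Greatest Q) \<le> Greatest Q" unfolding lw .
    then show False by simp
  qed
  show ?thesis
  proof (rule that[of ws "\<lambda>z. g z * (\<Prod>w\<leftarrow>ws. 1 - cnj w * z)"])
    show "(\<lambda>z. g z * (\<Prod>w\<leftarrow>ws. 1 - cnj w * z)) holomorphic_on S"
      using Pw by (auto simp: P_def intro!: holomorphic_intros)
    fix z :: complex
    show "f z * (\<Prod>w\<leftarrow>ws. 1 - cnj w * z) = (\<Prod>w\<leftarrow>ws. z - w) * (g z * (\<Prod>w\<leftarrow>ws. 1 - cnj w * z))" if "z \<in> S"
      using Pw that by (simp add: P_def)
    show "g z * (\<Prod>w\<leftarrow>ws. 1 - cnj w * z) \<noteq> 0" if "norm z \<le> 1/2"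
      using nz[OF that] dens[of ws z] Pw that by (auto simp: P_def)
    show "norm (g z * (\<Prod>w\<leftarrow>ws. 1 - cnj w * z)) \<le> exp A * norm (g 0 * (\<Prod>w\<leftarrow>ws. 1 - cnj w * 0))"
      if "norm z \<le> 1"
    proof -
      have "norm (g z * (\<Prod>w\<leftarrow>ws. 1 - cnj w * z)) \<le> exp A * norm (f 0)" using main[OF Pw] that by blast
      also have "\<dots> \<le> exp A * norm (g 0)" using main[OF Pw] by simp
      finally show ?thesis by (simp add: map_replicate_const)
    qed
  qed (use Pw main in \<open>auto simp: P_def\<close>)
qed

text \<open>Logarithmic differentiation of the identity in \<open>factor_out_zeros\<close>: the
  factors z - w give the simple fractions, the zero-free cofactor contributes at most 32A by
  \<open>log_deriv_zero_free\<close>, and the factors 1 - cnj w * z at most 1 each, hence 2A in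
  all.\<close>

lemma log_deriv_approx:
  assumes hol: "f holomorphic_on S" "open S" "cball 0 1 \<subseteq> S" and f0: "f 0 \<noteq> 0" and A: "A > 0"
    and bd: "\<And>z. norm z = 1 \<Longrightarrow> norm (f z) \<le> exp A * norm (f 0)"
  obtains ws where "\<And>w. w \<in> set ws \<Longrightarrow> norm w \<le> 1/2" "real (length ws) \<le> 2 * A"
    "\<And>z. \<lbrakk>norm z \<le> 1/8; f z \<noteq> 0\<rbrakk> \<Longrightarrow> z \<notin> set ws"
    "\<And>z. \<lbrakk>norm z \<le> 1/8; f z \<noteq> 0\<rbrakk> \<Longrightarrow> norm (deriv f z / f z - (\<Sum>w\<leftarrow>ws. 1 / (z - w))) \<le> 34 * A"
proof -
  obtain ws g where ws: "\<And>w. w \<in> set ws \<Longrightarrow> norm w \<le> 1/2" "2 ^ length ws \<le> exp A"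
    and g: "g holomorphic_on S"
    and fg: "\<And>z. z \<in> S \<Longrightarrow> f z * (\<Prod>w\<leftarrow>ws. 1 - cnj w * z) = (\<Prod>w\<leftarrow>ws. z - w) * g z"
    and nz: "\<And>z. norm z \<le> 1/2 \<Longrightarrow> g z \<noteq> 0" and gb: "\<And>z. norm z \<le> 1 \<Longrightarrow> norm (g z) \<le> exp A * norm (g 0)"
    using factor_out_zeros[OF hol f0 bd] by metis
  have "real (length ws) * ln 2 \<le> A"
    using ws(2) by (metis exp_gt_zero ln_exp ln_le_cancel_iff ln_realpow zero_less_numeral zero_less_power)
  \<comment> \<open>ln x <= x - 1 at x = 1/2 gives ln 2 >= 1/2, which turns 2^m <= e^A into m <=
    2A.\<close>
  moreover have "real (length ws) * (1/2) \<le> real (length ws) * ln 2"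
    using ln_le_minus_one[of "1/2"] by (intro mult_left_mono) (auto simp: ln_div)
  ultimately have len: "real (length ws) \<le> 2 * A" by simp
  show ?thesis
  proof (rule that[of ws])
    fix z assume z: "norm z \<le> 1/8" and fz: "f z \<noteq> 0"
    have zS: "z \<in> S" using z hol(3) by auto
    let ?B = "\<lambda>z. \<Prod>w\<leftarrow>ws. 1 - cnj w * z" and ?N = "\<lambda>z. \<Prod>w\<leftarrow>ws. z - w"
    have half: "norm (1 - cnj w * z) \<ge> 1/2" if "w \<in> set ws" for w
    proof -
      have "norm (cnj w * z) \<le> 1/2 * (1/8)"
        unfolding norm_mult using ws(1)[OF that] z by (intro mult_mono) auto
      then show ?thesis using norm_triangle_ineq2[of 1 "cnj w * z"] by simp
    qed
    have Bne: "1 - cnj w * z \<noteq> 0" if "w \<in> set ws" for w using half[OF that] by auto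
    then have Bz: "?B z \<noteq> 0" by (auto simp: prod_list_zero_iff)
    have Nz: "?N z \<noteq> 0" using fg[OF zS] fz Bz by auto
    then have Nne: "z - w \<noteq> 0" if "w \<in> set ws" for w using that by (auto simp: prod_list_zero_iff)
    then show "z \<notin> set ws" by auto
    have df: "(f has_field_derivative deriv f z) (at z)" and dg: "(g has_field_derivative deriv g z) (at z)"
      using hol g zS holomorphic_derivI by blast+
    have dB: "(?B has_field_derivative ?B z * (\<Sum>w\<leftarrow>ws. - cnj w / (1 - cnj w * z))) (at z)"
      by (rule has_field_derivative_prod_list_div) (use Bne in \<open>auto intro!: derivative_eq_intros\<close>)
    have dN: "(?N has_field_derivative ?N z * (\<Sum>w\<leftarrow>ws. 1 / (z - w))) (at z)"
      by (rule has_field_derivative_prod_list_div) (use Nne in \<open>auto intro!: derivative_eq_intros\<close>)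
    have "((\<lambda>z. ?N z * g z) has_field_derivative
        ?N z * (\<Sum>w\<leftarrow>ws. 1 / (z - w)) * g z + deriv g z * ?N z) (at z)"
      by (rule DERIV_mult[OF dN dg])
    moreover have ev: "\<forall>\<^sub>F x in nhds z. f x * ?B x = ?N x * g x"
      using zS hol(2) fg by (auto simp: eventually_nhds)
    moreover have "((\<lambda>z. f z * ?B z) has_field_derivative
        deriv f z * ?B z + ?B z * (\<Sum>w\<leftarrow>ws. - cnj w / (1 - cnj w * z)) * f z) (at z)"
      by (rule DERIV_mult[OF df dB])
    ultimately have "deriv f z * ?B z + ?B z * (\<Sum>w\<leftarrow>ws. - cnj w / (1 - cnj w * z)) * f z =
        ?N z * (\<Sum>w\<leftarrow>ws. 1 / (z - w)) * g z + deriv g z * ?N z"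
      unfolding DERIV_cong_ev[OF refl ev refl] using DERIV_unique by blast
    moreover have gz: "g z \<noteq> 0" using nz z by simp
    \<comment> \<open>Both sides are divided by the same nonzero number, written in two ways through
      \<open>fg\<close>.\<close>
    ultimately have "(deriv f z * ?B z + ?B z * (\<Sum>w\<leftarrow>ws. - cnj w / (1 - cnj w * z)) * f z) / (f z * ?B z) =
        (?N z * (\<Sum>w\<leftarrow>ws. 1 / (z - w)) * g z + deriv g z * ?N z) / (?N z * g z)"
      using fg[OF zS] by simp
    then have "deriv f z / f z + (\<Sum>w\<leftarrow>ws. - cnj w / (1 - cnj w * z)) = deriv g z / g z + (\<Sum>w\<leftarrow>ws. 1 / (z - w))"
      using fz gz Bz Nz by (simp add: add_divide_distrib add.commute)
    then have "deriv f z / f z - (\<Sum>w\<leftarrow>ws. 1 / (z - w)) = deriv g z / g z - (\<Sum>w\<leftarrow>ws. - cnj w / (1 - cnj w * z))"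
      by (simp only: diff_eq_eq) (simp only: add_diff_eq diff_add_eq add.commute eq_diff_eq)
    also have "norm \<dots> \<le> norm (deriv g z / g z) + norm (\<Sum>w\<leftarrow>ws. - cnj w / (1 - cnj w * z))"
      by (rule norm_triangle_ineq4)
    also have "norm (deriv g z / g z) \<le> 32 * A"
    proof (rule log_deriv_zero_free[OF _ _ _ A z])
      show "g holomorphic_on ball 0 (1/2)"
        by (rule holomorphic_on_subset[OF g]) (use hol(3) in force)
    qed (use nz gb in auto)
    also have "norm (\<Sum>w\<leftarrow>ws. - cnj w / (1 - cnj w * z)) \<le> (\<Sum>w\<leftarrow>ws. 1)"
    proof -
      have "norm (\<Sum>w\<leftarrow>ws. - cnj w / (1 - cnj w * z)) \<le> (\<Sum>w\<leftarrow>ws. norm (- cnj w / (1 - cnj w * z)))"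
        by (rule norm_sum_list_le)
      also have "\<dots> \<le> (\<Sum>w\<leftarrow>ws. 1)"
      proof (rule sum_list_mono)
        fix w assume w: "w \<in> set ws"
        show "norm (- cnj w / (1 - cnj w * z)) \<le> 1"
          using half[OF w] ws(1)[OF w] by (simp add: norm_divide divide_le_eq)
      qed
      finally show ?thesis .
    qed
    finally show "norm (deriv f z / f z - (\<Sum>w\<leftarrow>ws. 1 / (z - w))) \<le> 34 * A"
      using len by (simp add: sum_list_triv)
  qed (use ws len in auto)
qed

subsection \<open>The weak-type bound for simple fractions\<close>

lemma holomorphic_on_sum_list [holomorphic_intros]:
  assumes "\<And>w. w \<in> set ws \<Longrightarrow> f w holomorphic_on S"
  shows "(\<lambda>z. \<Sum>w\<leftarrow>ws. f w z) holomorphic_on S"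
  using assms by (induction ws) (auto intro!: holomorphic_intros)

lemma tendsto_sum_list:
  fixes f :: "'b \<Rightarrow> 'c \<Rightarrow> 'a :: topological_monoid_add"
  assumes "\<And>w. w \<in> set ws \<Longrightarrow> (f w \<longlongrightarrow> l w) F"
  shows "((\<lambda>x. \<Sum>w\<leftarrow>ws. f w x) \<longlongrightarrow> (\<Sum>w\<leftarrow>ws. l w)) F"
  using assms by (induction ws) (auto intro!: tendsto_intros)

text \<open>Each 1/(z - w) has nonpositive imaginary part, and multiplication by i turns this into a
  nonnegative real part. A pole at \<open>z\<close> itself contributes 0, since 1/0 = 0.\<close>

lemma Re_i_mult_sum_list_nonneg:
  assumes "\<And>w. w \<in> set ws \<Longrightarrow> Im w \<le> Im z"
  shows "0 \<le> Re (\<i> * (\<Sum>w\<leftarrow>ws. 1 / (z - w)))"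
  using assms
proof (induction ws)
  case (Cons w ws)
  have "Im (1 / (z - w)) \<le> 0"
    using Cons.prems[of w] by (simp add: Im_divide divide_nonpos_nonneg)
  then show ?case using Cons by simp
qed simp

text \<open>The Moebius map x/(x + u) sends the right half plane into the disc with diameter [0, 1]
  and the arc |x| = u into the line Re = 1/2, with |x| > u to the right of that line.\<close>

lemma Re_divide_add_of_real:
  assumes "0 \<le> Re x" "0 < u"
  shows "0 \<le> Re (x / (x + of_real u))" "u \<le> norm x \<Longrightarrow> 1/2 \<le> Re (x / (x + of_real u))"
proof -
  have e: "Re (x / (x + of_real u)) = ((norm x)\<^sup>2 + u * Re x) / ((norm x)\<^sup>2 + 2 * u * Re x + u\<^sup>2)"
    unfolding Re_divide cmod_power2 by (simp add: power2_eq_square algebra_simps)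
  have pos: "0 < (norm x)\<^sup>2 + 2 * u * Re x + u\<^sup>2"
    using assms by (intro add_nonneg_pos) auto
  show "0 \<le> Re (x / (x + of_real u))"
    unfolding e using assms pos by (intro divide_nonneg_pos) auto
  show "1/2 \<le> Re (x / (x + of_real u))" if "u \<le> norm x"
  proof -
    have "u\<^sup>2 \<le> (norm x)\<^sup>2" using that assms by (intro power_mono) auto
    then show ?thesis unfolding e using pos by (simp add: le_divide_eq)
  qed
qed

text \<open>Cauchy's theorem moves the integral of \<open>H\<close> from the diameter to the arc of
  radius 2r, far from the poles. The non-strict inequality in \<open>S\<close> makes it compact,
  which settles measurability here and for the intersections taken in the limit argument.\<close>

lemma weak_type_lower_half_plane:
  assumes ws: "\<And>w. w \<in> set ws \<Longrightarrow> Im w < 0" "\<And>w. w \<in> set ws \<Longrightarrow> norm w \<le> r" and r: "0 < r" and u: "0 < u"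
  defines "S \<equiv> {t \<in> {- 2 * r..2 * r}. u \<le> norm (\<Sum>w\<leftarrow>ws. 1 / (of_real t - w))}"
  shows "compact S" "measure lebesgue S \<le> 4 * pi * length ws / u"
proof -
  define R where "R = 2 * r"
  define N where "N = real (length ws)"
  define G where "G z = \<i> * (\<Sum>w\<leftarrow>ws. 1 / (z - w))" for z
  define H where "H z = G z / (G z + of_real u)" for z
  \<comment> \<open>\<open>V\<close> contains the closed upper half plane because the poles lie
    strictly below the real line; its convexity gives Cauchy's theorem for the half-disc
    contour.\<close>
  define V where "V = (\<Inter>w\<in>set ws. {z. Im z > Im w})"
  have R: "R > 0" and Rr: "R = r + r" using r by (auto simp: R_def)
  have V0: "z \<in> V" if "Im z \<ge> 0" for z
    unfolding V_def using ws(1) that by force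
  have convV: "convex V"
    unfolding V_def by (intro convex_INT) (auto intro: convex_halfspace_Im_gt)
  have G: "G holomorphic_on V"
    unfolding G_def by (intro holomorphic_intros) (auto simp: V_def)
  have ReG: "0 \<le> Re (G z)" if "z \<in> V" for z
    unfolding G_def using that by (intro Re_i_mult_sum_list_nonneg) (auto simp: V_def intro: less_imp_le)
  have u_le: "u \<le> norm (G z + of_real u)" if "z \<in> V" for z
    using ReG[OF that] complex_Re_le_cmod[of "G z + of_real u"] by simp
  have H: "H holomorphic_on V"
    unfolding H_def by (intro holomorphic_intros G) (use u_le u in force)
  have lV: "path_image (linepath (of_real (-R)) (of_real R)) \<subseteq> V"
    using closed_segment_subset[OF V0 V0 convV, of "of_real (-R)" "of_real R"] by simp
  have cV: "path_image (part_circlepath 0 R 0 pi) \<subseteq> V"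
  proof
    fix z assume "z \<in> path_image (part_circlepath 0 R 0 pi)"
    then obtain x where "z = R * exp (\<i> * of_real x)" "0 \<le> x" "x \<le> pi"
      by (auto simp: path_image_part_circlepath)
    then show "z \<in> V" using R by (intro V0) (simp add: Im_exp sin_ge_zero)
  qed
  have "(H has_contour_integral 0) (linepath (of_real (-R)) (of_real R) +++ part_circlepath 0 R 0 pi)"
  proof (rule Cauchy_theorem_convex_simple[OF H convV])
    show "path_image (linepath (of_real (-R)) (of_real R) +++ part_circlepath 0 R 0 pi) \<subseteq> V"
      using lV cV by (intro subset_path_image_join)
  qed (auto simp: exp_eq_polar intro!: valid_path_join)
  moreover obtain i1 where i1: "(H has_contour_integral i1) (linepath (of_real (-R)) (of_real R))"
    using contour_integrable_continuous_linepath[of "of_real (-R)" "of_real R" H]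
      holomorphic_on_imp_continuous_on[OF holomorphic_on_subset[OF H lV]]
    by (auto simp: contour_integrable_on_def)
  moreover obtain i2 where i2: "(H has_contour_integral i2) (part_circlepath 0 R 0 pi)"
    using contour_integrable_continuous_part_circlepath
      holomorphic_on_imp_continuous_on[OF holomorphic_on_subset[OF H cV]]
    unfolding contour_integrable_on_def by blast
  ultimately have "i1 + i2 = 0"
    by (meson has_contour_integral_join has_contour_integral_unique valid_path_linepath valid_path_part_circlepath)
  \<comment> \<open>The arc keeps distance at least r from the poles, so |H| <= N/(r u) there; its
    length 2 \<pi> r makes the bound free of r.\<close>
  moreover have "norm i2 \<le> N / r / u * R * (pi - 0)"
  proof (rule has_contour_integral_bound_part_circlepath[OF i2])
    fix z assume z: "z \<in> path_image (part_circlepath 0 R 0 pi)"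
    have nz: "norm z = R" using in_path_image_part_circlepath[OF z] R by simp
    have "norm (\<Sum>w\<leftarrow>ws. 1 / (z - w)) \<le> (\<Sum>w\<leftarrow>ws. norm (1 / (z - w)))"
      by (rule norm_sum_list_le)
    also have "\<dots> \<le> (\<Sum>w\<leftarrow>ws. 1 / r)"
    proof (rule sum_list_mono)
      fix w assume "w \<in> set ws"
      then have "r \<le> norm (z - w)" using norm_triangle_ineq2[of z w] nz Rr ws(2)[of w] by linarith
      then show "norm (1 / (z - w)) \<le> 1 / r" using r by (simp add: norm_divide frac_le)
    qed
    finally have "norm (G z) \<le> N / r" by (simp add: G_def norm_mult N_def sum_list_triv)
    then show "norm (H z) \<le> N / r / u"
      unfolding H_def norm_divide using u_le[of z] z cV u r N_def by (intro frac_le) auto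
  qed (use u r R N_def in auto)
  moreover have "N / r / u * R * (pi - 0) = 2 * pi * N / u"
    using r by (simp add: R_def)
  ultimately have Re1: "Re i1 \<le> 2 * pi * N / u"
    using complex_Re_le_cmod[of "- i2"] by (simp add: add_eq_0_iff2)
  have "((\<lambda>x. H (of_real x)) has_integral i1) {-R..R}"
    using i1 R by (subst (asm) has_contour_integral_linepath_Reals_iff) auto
  from has_integral_linear[OF this bounded_linear_Re]
  have intH: "((\<lambda>x. Re (H (of_real x))) has_integral Re i1) {-R..R}" by (simp add: o_def)
  have SR: "S \<subseteq> {-R..R}" by (auto simp: S_def R_def)
  have "continuous_on UNIV (\<lambda>t. norm (G (of_real t)))"
    by (intro continuous_intros continuous_on_compose2[OF holomorphic_on_imp_continuous_on[OF G]]) (auto intro: V0)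
  then have "closed {t. u \<le> norm (G (of_real t))}"
    by (intro closed_Collect_le continuous_on_const)
  moreover have "S = {-R..R} \<inter> {t. u \<le> norm (G (of_real t))}"
    by (auto simp: S_def R_def G_def norm_mult)
  ultimately show "compact S" by (auto intro: compact_Int_closed)
  then have S: "S \<in> lmeasurable" by (rule lmeasurable_compact)
  have "(indicat_real S has_integral measure lebesgue S) {-R..R}"
    using integral_indicator[of S "{-R..R}"] integrable_on_indicator[of S "{-R..R}"] S SR
    by (simp add: has_integral_iff inf.absorb1)
  then have "((\<lambda>x. 1/2 * indicat_real S x) has_integral 1/2 * measure lebesgue S) {-R..R}"
    by (rule has_integral_mult_right)
  \<comment> \<open>A Chebyshev estimate: on the diameter Re H is nonnegative, and at least 1/2 on
    \<open>S\<close>.\<close>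
  then have "1/2 * measure lebesgue S \<le> Re i1"
  proof (rule has_integral_le[OF _ intH])
    fix x assume "x \<in> {-R..R}"
    have "0 \<le> Re (G (of_real x))" by (intro ReG V0) auto
    from Re_divide_add_of_real[OF this u]
    show "1/2 * indicat_real S x \<le> Re (H (of_real x))"
      by (auto simp: H_def S_def indicator_def G_def norm_mult)
  qed
  then show "measure lebesgue S \<le> 4 * pi * length ws / u" using Re1 by (simp add: N_def)
qed

text \<open>Real poles are pushed down by $\varepsilon$, and the bound survives the limit because it does not
  depend on the distance of the poles from the real line.\<close>

lemma weak_type_closed_lower_half_plane:
  assumes ws: "\<And>w. w \<in> set ws \<Longrightarrow> Im w \<le> 0" "\<And>w. w \<in> set ws \<Longrightarrow> norm w \<le> r" and r: "0 < r" and u: "0 < u"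
  obtains X where "X \<in> lmeasurable" "measure lebesgue X \<le> 4 * pi * length ws / u"
    "{t \<in> {- 2 * r..2 * r}. of_real t \<notin> set ws \<and> u < norm (\<Sum>w\<leftarrow>ws. 1 / (of_real t - w))} \<subseteq> X"
proof -
  \<comment> \<open>The shift has size at most r, so the moved poles lie in the disc of radius 2r;
    hence the doubled radius in \<open>S\<close>.\<close>
  define e where "e k = \<i> * of_real (r / real (Suc k))" for k
  define S where "S k = {t \<in> {- 2 * (2 * r)..2 * (2 * r)}.
      u \<le> norm (\<Sum>w\<leftarrow>map (\<lambda>w. w - e k) ws. 1 / (of_real t - w))}" for k
  \<comment> \<open>The increasing union of the \<open>T m\<close> is the lower limit of the sets
    \<open>S k\<close>. Each \<open>T m\<close> lies inside \<open>S m\<close>, so the common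
    measure bound passes to the union.\<close>
  define T where "T m = (\<Inter>k\<in>{m..}. S k)" for m :: nat
  have e: "norm (e k) \<le> r" "Im (e k) > 0" for k
    using r unfolding e_def norm_mult norm_of_real by (auto simp: divide_le_eq mult_le_cancel_left1)
  have S: "compact (S k)" "measure lebesgue (S k) \<le> 4 * pi * length ws / u" for k
  proof -
    have *: "Im w < 0" "norm w \<le> 2 * r" if "w \<in> set (map (\<lambda>w. w - e k) ws)" for w
    proof -
      from that obtain v where "v \<in> set ws" "w = v - e k" by auto
      then show "Im w < 0" "norm w \<le> 2 * r"
        using ws[of v] e[of k] norm_triangle_ineq4[of v "e k"] by auto
    qed
    have "0 < 2 * r" using r by simp
    note lower = weak_type_lower_half_plane[of "map (\<lambda>w. w - e k) ws" "2 * r" u, OF *(1) *(2) this u, folded S_def]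
    show "compact (S k)" "measure lebesgue (S k) \<le> 4 * pi * length ws / u"
      using lower by (simp_all only: length_map)
  qed
  have Sl: "S k \<in> lmeasurable" for k using S by (intro lmeasurable_compact)
  have Tc: "compact (T m)" for m
    using S unfolding T_def by (intro compact_Inter) auto
  have Tl: "T m \<in> lmeasurable" for m using Tc by (intro lmeasurable_compact)
  have Tb: "measure lebesgue (T m) \<le> 4 * pi * length ws / u" for m
  proof -
    have "measure lebesgue (T m) \<le> measure lebesgue (S m)"
      using Tl Sl by (intro measure_mono_fmeasurable) (auto simp: T_def)
    then show ?thesis using S(2)[of m] by linarith
  qed
  have inc: "incseq T" by (auto simp: incseq_def T_def)
  have UT: "(\<Union>m. T m) \<in> lmeasurable"
  proof (rule fmeasurableI2)
    show "{- 2 * (2 * r)..2 * (2 * r)} \<in> lmeasurable" by simp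
    show "(\<Union>m. T m) \<subseteq> {- 2 * (2 * r)..2 * (2 * r)}" by (auto simp: T_def S_def)
    show "(\<Union>m. T m) \<in> sets lebesgue" using Tl by blast
  qed
  have "(\<lambda>m. measure lebesgue (T m)) \<longlonglongrightarrow> measure lebesgue (\<Union>m. T m)"
    using inc Tl UT by (intro Lim_measure_incseq) (auto simp: fmeasurable_def less_top)
  then have "measure lebesgue (\<Union>m. T m) \<le> 4 * pi * length ws / u"
    by (rule LIMSEQ_le_const2) (use Tb in auto)
  moreover have "{t \<in> {- 2 * r..2 * r}. of_real t \<notin> set ws \<and> u < norm (\<Sum>w\<leftarrow>ws. 1 / (of_real t - w))}
      \<subseteq> (\<Union>m. T m)"
  proof safe
    fix t assume t: "t \<in> {- 2 * r..2 * r}" "of_real t \<notin> set ws"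
      and ut: "u < norm (\<Sum>w\<leftarrow>ws. 1 / (of_real t - w))"
    have "(\<lambda>k. r / real (Suc k)) \<longlonglongrightarrow> 0"
      using tendsto_mult_right_zero[OF lim_inverse_n', of r] LIMSEQ_Suc[of "\<lambda>n. r / real n" 0]
      by (simp add: divide_inverse)
    from tendsto_of_real[OF this] have "(\<lambda>k. complex_of_real (r / real (Suc k))) \<longlonglongrightarrow> 0"
      by (simp only: of_real_0)
    then have e0: "e \<longlonglongrightarrow> 0"
      unfolding e_def by (rule tendsto_mult_right_zero)
    \<comment> \<open>Off the poles the shifted sums converge to the original one, and a strict
      inequality in the limit holds for all large k.\<close>
    have "(\<lambda>k. norm (\<Sum>w\<leftarrow>ws. 1 / (of_real t - (w - e k)))) \<longlonglongrightarrow> norm (\<Sum>w\<leftarrow>ws. 1 / (of_real t - (w - 0)))"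
      using t by (intro tendsto_norm tendsto_sum_list tendsto_divide tendsto_diff tendsto_const e0) auto
    then have "eventually (\<lambda>k. u < norm (\<Sum>w\<leftarrow>ws. 1 / (of_real t - (w - e k)))) sequentially"
      using ut by (intro order_tendstoD(1)) auto
    then obtain m where m: "\<And>k. k \<ge> m \<Longrightarrow> u < norm (\<Sum>w\<leftarrow>ws. 1 / (of_real t - (w - e k)))"
      by (auto simp: eventually_sequentially)
    have "t \<in> T m"
      unfolding T_def S_def using m t r by (auto simp: o_def intro: less_imp_le)
    then show "t \<in> (\<Union>m. T m)" by blast
  qed
  ultimately show ?thesis using that UT by blast
qed

text \<open>Poles above the real line are reflected by conjugation, which at real t keeps the
  modulus of their sum. One of the two partial sums must exceed u/2, whence twice the constant for a
  single half plane.\<close>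

lemma weak_type_log_deriv:
  fixes ws :: "complex list"
  assumes ws: "\<And>w. w \<in> set ws \<Longrightarrow> norm w \<le> r" and r: "0 < r" and u: "0 < u"
  obtains X where "X \<in> lmeasurable" "measure lebesgue X \<le> 8 * pi * length ws / u"
    "{t \<in> {- 2 * r..2 * r}. of_real t \<notin> set ws \<and> u < norm (\<Sum>w\<leftarrow>ws. 1 / (of_real t - w))} \<subseteq> X"
proof -
  define us where "us = filter (\<lambda>w. Im w \<le> 0) ws"
  define vs where "vs = map cnj (filter (\<lambda>w. \<not> Im w \<le> 0) ws)"
  have u2: "0 < u / 2" using u by simp
  obtain X where X: "X \<in> lmeasurable" "measure lebesgue X \<le> 4 * pi * length us / (u / 2)"
    "{t \<in> {- 2 * r..2 * r}. of_real t \<notin> set us \<and> u / 2 < norm (\<Sum>w\<leftarrow>us. 1 / (of_real t - w))} \<subseteq> X"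
    by (rule weak_type_closed_lower_half_plane[OF _ _ r u2, of us]) (use ws in \<open>auto simp: us_def\<close>)
  obtain Y where Y: "Y \<in> lmeasurable" "measure lebesgue Y \<le> 4 * pi * length vs / (u / 2)"
    "{t \<in> {- 2 * r..2 * r}. of_real t \<notin> set vs \<and> u / 2 < norm (\<Sum>w\<leftarrow>vs. 1 / (of_real t - w))} \<subseteq> Y"
    by (rule weak_type_closed_lower_half_plane[OF _ _ r u2, of vs]) (use ws in \<open>auto simp: vs_def\<close>)
  have len: "length us + length vs = length ws"
    unfolding us_def vs_def using sum_length_filter_compl[of "\<lambda>w. Im w \<le> 0" ws] by simp
  show ?thesis
  proof (rule that[of "X \<union> Y"])
    show "X \<union> Y \<in> lmeasurable" using X Y by auto
    have "measure lebesgue (X \<union> Y) \<le> measure lebesgue X + measure lebesgue Y"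
      using X Y by (intro measure_Un_le) auto
    also have "\<dots> \<le> 8 * pi * real (length us + length vs) / u"
      using X(2) Y(2) by (simp add: ring_distribs add_divide_distrib)
    finally show "measure lebesgue (X \<union> Y) \<le> 8 * pi * length ws / u" unfolding len .
    show "{t \<in> {- 2 * r..2 * r}. of_real t \<notin> set ws \<and> u < norm (\<Sum>w\<leftarrow>ws. 1 / (of_real t - w))} \<subseteq> X \<union> Y"
    proof safe
      fix t assume t: "t \<in> {- 2 * r..2 * r}" "of_real t \<notin> set ws"
        and ut: "u < norm (\<Sum>w\<leftarrow>ws. 1 / (of_real t - w))" and "t \<notin> Y"
      have cn: "(\<Sum>w\<leftarrow>xs. 1 / (of_real t - cnj w)) = cnj (\<Sum>w\<leftarrow>xs. 1 / (of_real t - w))" for xs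
        by (induction xs) auto
      have "(\<Sum>w\<leftarrow>ws. 1 / (of_real t - w)) = (\<Sum>w\<leftarrow>us. 1 / (of_real t - w)) +
          (\<Sum>w\<leftarrow>filter (\<lambda>w. \<not> Im w \<le> 0) ws. 1 / (of_real t - w))"
        unfolding us_def by (induction ws) auto
      then have "norm (\<Sum>w\<leftarrow>ws. 1 / (of_real t - w)) \<le> norm (\<Sum>w\<leftarrow>us. 1 / (of_real t - w)) +
          norm (cnj (\<Sum>w\<leftarrow>filter (\<lambda>w. \<not> Im w \<le> 0) ws. 1 / (of_real t - w)))"
        unfolding complex_mod_cnj by (metis norm_triangle_ineq)
      also have "cnj (\<Sum>w\<leftarrow>filter (\<lambda>w. \<not> Im w \<le> 0) ws. 1 / (of_real t - w)) = (\<Sum>w\<leftarrow>vs. 1 / (of_real t - w))"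
        unfolding vs_def cn[symmetric] by (simp add: o_def)
      finally have or: "u / 2 < norm (\<Sum>w\<leftarrow>us. 1 / (of_real t - w)) \<or> u / 2 < norm (\<Sum>w\<leftarrow>vs. 1 / (of_real t - w))"
        using ut by linarith
      have "of_real t \<notin> set us" using t by (auto simp: us_def)
      \<comment> \<open>The entries of \<open>vs\<close> have negative imaginary part.\<close>
      moreover have "of_real t \<notin> set vs" by (auto simp: vs_def complex_eq_iff)
      ultimately show "t \<in> X" using or X(3) Y(3) t \<open>t \<notin> Y\<close> by blast
    qed
  qed
qed

subsection \<open>Exponential polynomials\<close>

text \<open>
  Constants: with $A = 34\rho$ there are at most $68\rho$ poles, and after rescaling by $8$ the error
  is $34A/8 = 289\rho/2$; then $4352 = 8 \cdot 4 \cdot 68 \cdot 2$, with $\pi < 4$.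
\<close>

lemma weak_type_exp_sum:
  fixes \<Gamma> :: "complex set" and b :: "complex \<Rightarrow> complex"
  assumes fin: "finite \<Gamma>" and le: "\<And>l. l \<in> \<Gamma> \<Longrightarrow> norm l \<le> \<rho>" and card: "real (card \<Gamma>) \<le> \<rho>" and \<rho>: "0 < \<rho>"
    and u: "289 \<le> u"
  defines "f \<equiv> \<lambda>z. \<Sum>l\<in>\<Gamma>. b l * exp (l * z)"
  obtains X where "X \<in> lmeasurable" "measure lebesgue X \<le> 4352 / u"
    "{t \<in> {-1/2..1/2}. f (of_real t) \<noteq> 0 \<and> u * \<rho> * norm (f (of_real t)) < norm (deriv f (of_real t))} \<subseteq> X"
proof -
  have hol: "f holomorphic_on UNIV" unfolding f_def by (intro holomorphic_intros)
  have "continuous_on (cball 0 (1/2)) (\<lambda>z. norm (f z))"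
    unfolding f_def by (intro continuous_intros)
  \<comment> \<open>Jensen's estimate compares the growth of f with its value at the centre; a
    maximum point of |f| on the half disc is a centre for which \<open>growth\<close> supplies this
    comparison.\<close>
  then obtain z0 where z0: "norm z0 \<le> 1/2" "\<And>z. norm z \<le> 1/2 \<Longrightarrow> norm (f z) \<le> norm (f z0)"
    using continuous_attains_sup[of "cball 0 (1/2) :: complex set" "\<lambda>z. norm (f z)"] by auto
  \<comment> \<open>With r = 1/2 the exponent 2\<rho> + 2 card \<Gamma> is at most 4\<rho>.\<close>
  have growth: "norm (f z) \<le> norm (f z0) * exp (4 * \<rho> * norm z)" for z
  proof -
    have "norm (f z) \<le> norm (f z0) * exp ((2 * \<rho> + card \<Gamma> / (1/2)) * norm z)"
      unfolding f_def by (rule exp_sum_growth_cball[OF fin le _ _ z0(2)[unfolded f_def]]) (use \<rho> in auto)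
    also have "\<dots> \<le> norm (f z0) * exp (4 * \<rho> * norm z)"
      using card by (intro mult_left_mono) (auto intro!: mult_right_mono)
    finally show ?thesis .
  qed
  show ?thesis
  proof (cases "f z0 = 0")
    case True
    then have "f z = 0" for z using growth[of z] by simp
    then show ?thesis using u by (intro that[of "{}"]) auto
  next
    case False
    \<comment> \<open>For t in [-1/2, 1/2] one has |t - z0| <= 1, so the scale 8 puts t at |w| <=
      1/8. The unit circle goes into |z| <= 17/2, and 4\<rho> * 17/2 = 34\<rho>.\<close>
    define F where "F w = f (z0 + 8 * w)" for w
    have F: "F holomorphic_on UNIV" unfolding F_def f_def by (intro holomorphic_intros)
    have F0: "F 0 \<noteq> 0" using False by (simp add: F_def)
    have A: "0 < 34 * \<rho>" using \<rho> by simp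
    have Fb: "norm (F w) \<le> exp (34 * \<rho>) * norm (F 0)" if "norm w = 1" for w
    proof -
      have "norm (z0 + 8 * w) \<le> 17/2"
        using norm_triangle_ineq[of z0 "8 * w"] z0(1) that by (simp add: norm_mult)
      then have "4 * \<rho> * norm (z0 + 8 * w) \<le> 4 * \<rho> * (17/2)" using \<rho> by (intro mult_left_mono) auto
      then have "exp (4 * \<rho> * norm (z0 + 8 * w)) \<le> exp (34 * \<rho>)" by simp
      then have "norm (f z0) * exp (4 * \<rho> * norm (z0 + 8 * w)) \<le> norm (f z0) * exp (34 * \<rho>)"
        by (rule mult_left_mono) simp
      then show ?thesis using growth[of "z0 + 8 * w"] by (simp add: F_def mult.commute)
    qed
    obtain ws where ws: "\<And>w. w \<in> set ws \<Longrightarrow> norm w \<le> 1/2" "real (length ws) \<le> 2 * (34 * \<rho>)"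
      "\<And>z. \<lbrakk>norm z \<le> 1/8; F z \<noteq> 0\<rbrakk> \<Longrightarrow> z \<notin> set ws"
      "\<And>z. \<lbrakk>norm z \<le> 1/8; F z \<noteq> 0\<rbrakk> \<Longrightarrow> norm (deriv F z / F z - (\<Sum>w\<leftarrow>ws. 1 / (z - w))) \<le> 34 * (34 * \<rho>)"
      using log_deriv_approx[OF F open_UNIV subset_UNIV F0 A Fb] by metis
    define vs where "vs = map (\<lambda>w. z0 + 8 * w) ws"
    \<comment> \<open>|z0| + 8 * 1/2 <= 9/2. With radius 5 the interval covered is [-10, 10], which
      contains [-1/2, 1/2].\<close>
    have vs: "norm v \<le> 5" if "v \<in> set vs" for v
    proof -
      obtain w where "w \<in> set ws" "v = z0 + 8 * w" using \<open>v \<in> set vs\<close> by (auto simp: vs_def)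
      then show ?thesis using norm_triangle_ineq[of z0 "8 * w"] z0(1) ws(1)[of w] by (simp add: norm_mult)
    qed
    have u2: "0 < u * \<rho> / 2" using u \<rho> by simp
    obtain X where X: "X \<in> lmeasurable" "measure lebesgue X \<le> 8 * pi * length vs / (u * \<rho> / 2)"
      "{t \<in> {- 2 * 5..2 * 5}. of_real t \<notin> set vs \<and> u * \<rho> / 2 < norm (\<Sum>w\<leftarrow>vs. 1 / (of_real t - w))} \<subseteq> X"
      by (rule weak_type_log_deriv[OF vs _ u2]) auto
    show ?thesis
    proof (rule that[OF X(1)])
      have "pi * real (length ws) \<le> 4 * (68 * \<rho>)"
        using pi_less_4 ws(2) by (intro mult_mono) auto
      then have "8 * pi * length vs / (u * \<rho> / 2) \<le> 8 * (4 * (68 * \<rho>)) / (u * \<rho> / 2)"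
        unfolding vs_def using u2 by (intro divide_right_mono) auto
      also have "\<dots> = 4352 / u" using u \<rho> by (simp add: field_simps)
      finally show "measure lebesgue X \<le> 4352 / u" using X(2) by linarith
    next
      show "{t \<in> {-1/2..1/2}. f (of_real t) \<noteq> 0 \<and> u * \<rho> * norm (f (of_real t)) < norm (deriv f (of_real t))} \<subseteq> X"
      proof safe
        fix t :: real assume t: "t \<in> {-1/2..1/2}" and ft: "f (of_real t) \<noteq> 0"
          and ut: "u * \<rho> * norm (f (of_real t)) < norm (deriv f (of_real t))"
        define w where "w = (of_real t - z0) / 8"
        have tw: "of_real t = z0 + 8 * w" by (simp add: w_def diff_divide_distrib)
        have "norm (of_real t :: complex) \<le> 1/2" unfolding norm_of_real using t by auto
        then have w: "norm w \<le> 1/8"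
          using norm_triangle_ineq4[of "of_real t" z0] z0(1) by (simp add: w_def norm_divide)
        have Fw: "F w = f (of_real t)" by (simp add: F_def tw)
        have "(f has_field_derivative deriv f (of_real t)) (at (z0 + 8 * w))"
          unfolding tw using hol holomorphic_derivI open_UNIV by blast
        then have "(F has_field_derivative deriv f (of_real t) * 8) (at w)"
          unfolding F_def by (rule DERIV_chain2) (auto intro!: derivative_eq_intros)
        then have dF: "deriv F w = 8 * deriv f (of_real t)" by (simp add: DERIV_imp_deriv)
        have eq: "(\<Sum>v\<leftarrow>vs. 1 / (of_real t - v)) = (\<Sum>w'\<leftarrow>ws. 1 / (w - w')) / 8"
        proof -
          have "1 / (8 * w - 8 * w') = 1 / (w - w') / 8" for w'
            by (metis right_diff_distrib divide_divide_eq_left mult.commute)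
          then show ?thesis
            unfolding vs_def tw by (induction ws) (simp_all add: add_divide_distrib mult.commute)
        qed
        have fw: "F w \<noteq> 0" using ft Fw by simp
        define D where "D = deriv f (of_real t) / f (of_real t)"
        have "8 * D - (\<Sum>w'\<leftarrow>ws. 1 / (w - w')) = (D - (\<Sum>v\<leftarrow>vs. 1 / (of_real t - v))) * 8"
          unfolding eq by (simp add: algebra_simps)
        moreover have "norm (8 * D - (\<Sum>w'\<leftarrow>ws. 1 / (w - w'))) \<le> 34 * (34 * \<rho>)"
          using ws(4)[OF w fw] by (simp add: dF Fw D_def)
        ultimately have "norm ((D - (\<Sum>v\<leftarrow>vs. 1 / (of_real t - v))) * 8) \<le> 34 * (34 * \<rho>)"
          by (simp only:)
        then have "norm (D - (\<Sum>v\<leftarrow>vs. 1 / (of_real t - v))) \<le> 289 * \<rho> / 2"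
          unfolding norm_mult by simp
        moreover have "289 * \<rho> \<le> u * \<rho>" using u \<rho> by simp
        moreover have "u * \<rho> < norm D"
          using ut ft by (simp add: D_def norm_divide less_divide_eq)
        \<comment> \<open>The error is at most 289\<rho>/2 <= u\<rho>/2, so the simple fractions
          account for more than half of u\<rho>.\<close>
        ultimately have "u * \<rho> / 2 < norm (\<Sum>v\<leftarrow>vs. 1 / (of_real t - v))"
          using norm_triangle_sub[of D "\<Sum>v\<leftarrow>vs. 1 / (of_real t - v)"] by linarith
        moreover have "of_real t \<notin> set vs"
          using ws(3)[OF w fw] by (auto simp: vs_def tw)
        ultimately show "t \<in> X" using t by (intro subsetD[OF X(3)]) auto
      qed
    qed
  qed
qed


section \<open>Reduction to a = 0\<close>

theorem lemma4p2:
  fixes A\<^sub>0 :: real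
  assumes "A\<^sub>0 \<ge> 1"
  shows "\<exists>C::real. C > 0 \<and>
    (\<forall>(n::nat) \<Gamma> b a (u::real).
       n \<ge> 2 \<longrightarrow> reduced_of_exact_order n \<Gamma> b \<longrightarrow> diameter \<Gamma> > A\<^sub>0 * real n \<longrightarrow>
       a \<in> \<Gamma> \<longrightarrow> u > 0 \<longrightarrow>
       measure lebesgue
         {t \<in> I\<^sub>0. exp_poly \<Gamma> b t \<noteq> 0 \<and>
                norm (Q_quot \<Gamma> b a t) > u * norm (exp_poly \<Gamma> b t)} \<le> C / u)"
proof (intro exI[of _ 4352] conjI allI impI)
  fix n :: nat and \<Gamma> b a and u :: real
  assume "reduced_of_exact_order n \<Gamma> b" and diam: "diameter \<Gamma> > A\<^sub>0 * real n"
    and a: "a \<in> \<Gamma>" and u: "u > 0"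
  then have fin: "finite \<Gamma>" and card: "card \<Gamma> = n" by (auto simp: reduced_of_exact_order_def)
  let ?S = "{t \<in> I\<^sub>0. exp_poly \<Gamma> b t \<noteq> 0 \<and> norm (Q_quot \<Gamma> b a t) > u * norm (exp_poly \<Gamma> b t)}"
  define \<rho> where "\<rho> = diameter \<Gamma>"
  \<comment> \<open>The hypothesis on \<rho> enters as n < \<rho>, so the same constant serves every
    \<open>A\<^sub>0\<close> >= 1.\<close>
  have "1 * real n \<le> A\<^sub>0 * real n" using assms by (intro mult_right_mono) auto
  then have n\<rho>: "real n < \<rho>" using diam by (simp add: \<rho>_def)
  then have \<rho>: "0 < \<rho>" by linarith
  show "measure lebesgue ?S \<le> 4352 / u"
  proof (cases "289 \<le> u")
    case False
    \<comment> \<open>For u < 289 the trivial bound 1 suffices, since then 4352/u > 1.\<close>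
    have "measure lebesgue ?S \<le> measure lebesgue {-1/2..1/2::real}"
      by (intro measure_mono_fmeasurable fmeasurableD large_ratio_set_lmeasurable) (auto simp: I\<^sub>0_def)
    also have "\<dots> \<le> 4352 / u" using False u by simp
    finally show ?thesis .
  next
    case True
    \<comment> \<open>As \<open>a\<close> belongs to \<Gamma>, the translated frequencies have
      modulus at most the diameter.\<close>
    define \<Delta> where "\<Delta> = (\<lambda>l. l - a) ` \<Gamma>"
    define f where "f = (\<lambda>z. \<Sum>l\<in>\<Delta>. b (l + a) * exp (l * z))"
    have inj: "inj_on (\<lambda>l. l - a) \<Gamma>" by (auto simp: inj_on_def)
    have \<Delta>: "finite \<Delta>" "card \<Delta> = n" using fin card by (auto simp: \<Delta>_def card_image inj)
    have le: "norm l \<le> \<rho>" if "l \<in> \<Delta>" for l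
      using that diameter_bounded_bound[OF finite_imp_bounded[OF fin] _ a]
      by (auto simp: \<Delta>_def \<rho>_def dist_norm)
    obtain X where X: "X \<in> lmeasurable" "measure lebesgue X \<le> 4352 / u"
      "{t \<in> {-1/2..1/2}. f (of_real t) \<noteq> 0 \<and> u * \<rho> * norm (f (of_real t)) < norm (deriv f (of_real t))} \<subseteq> X"
      using weak_type_exp_sum[OF \<Delta>(1) le _ \<rho> True, of "\<lambda>l. b (l + a)"] \<Delta>(2) n\<rho> unfolding f_def by auto
    \<comment> \<open>With q the exponential polynomial, f = e^(-a z) q, so f' = e^(-a z) (D - a) q;
      the exponential cancels from the comparison of |f'| with |f|.\<close>
    have f: "f z = exp (- a * z) * (\<Sum>l\<in>\<Gamma>. b l * exp (l * z))" for z
      unfolding f_def \<Delta>_def sum.reindex[OF inj] sum_distrib_left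
      by (intro sum.cong) (auto simp: algebra_simps simp flip: exp_add)
    have ft: "f (of_real t) = exp (- a * of_real t) * exp_poly \<Gamma> b t" for t
      by (simp add: f exp_poly_def)
    have dft: "deriv f (of_real t) = exp (- a * of_real t) * D_minus a (exp_poly \<Gamma> b) t" for t
    proof -
      have "(f has_field_derivative exp (- a * z) * ((\<Sum>l\<in>\<Gamma>. b l * (l * exp (l * z))) - a * (\<Sum>l\<in>\<Gamma>. b l * exp (l * z)))) (at z)" for z
        unfolding f[abs_def]
        by (auto intro!: derivative_eq_intros sum.cong simp: algebra_simps)
      then show ?thesis
        unfolding D_minus_def vector_derivative_at[OF exp_poly_has_vector_derivative]
        by (simp add: DERIV_imp_deriv exp_poly_def)
    qed
    have "?S \<subseteq> X"
    proof
      fix t assume t: "t \<in> ?S"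
      then have "u * norm (exp_poly \<Gamma> b t) < norm (D_minus a (exp_poly \<Gamma> b) t) / \<rho>"
        using \<rho> by (simp add: Q_quot_def norm_divide flip: \<rho>_def)
      then have "u * \<rho> * norm (exp_poly \<Gamma> b t) < norm (D_minus a (exp_poly \<Gamma> b) t)"
        using \<rho> by (simp add: less_divide_eq mult.assoc mult.commute[of \<rho>])
      then have "u * \<rho> * norm (f (of_real t)) < norm (deriv f (of_real t))"
        unfolding ft dft norm_mult by (simp add: mult.left_commute mult.assoc)
      then show "t \<in> X" using t X(3) by (auto simp: I\<^sub>0_def ft)
    qed
    then have "measure lebesgue ?S \<le> measure lebesgue X"
      by (intro measure_mono_fmeasurable X fmeasurableD large_ratio_set_lmeasurable)
    then show ?thesis using X(2) by linarith
  qed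
qed simp

end
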